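(* For every commodity $k$, given a sufficiently large value of $N$, the output of the path enumeration algorithm (described in the context), i.e. the list of paths $p^{(1)},p^{(2)},\dots$ it outputs, includes all bilevel feasible paths of $P^k$.
   Context: Let $G=(V,A)$ be a finite directed graph whose arc set is partitioned into a set $A_1$ of tolled arcs and a set $A_2$ of toll-free arcs. Each arc $a\in A$ has an initial cost $c_a>0$. A commodity $k$ has an origin $o^k\in V$ and a destination $d^k\in V$; it is assumed that there is at least one toll-free path (a path using no arc of $A_1$) from $o^k$ to $d^k$. $P^k$ is the set of all elementary (simple) directed paths from $o^k$ to $d^k$ in $G$. For a path $p$ and an arc $a$, $\delta_a^p=1$ if $p$ uses $a$ and $0$ otherwise. Costs and shortest paths in the algorithm are with respect to the initial costs: the (initial) cost of $p$ is $\sum_{a\in A}\delta_a^pc_a$. A path $p\in P^k$ is bilevel feasible if there exists $T=(T_a)_{a\in A_1}$ with $T\ge 0$ such that for all $q\in P^k$, $\sum_{a\in A}\delta_a^p c_a+\sum_{a\in A_1}\delta_a^p T_a\le \sum_{a\in A}\delta_a^q c_a+\sum_{a\in A_1}\delta_a^q T_a$. Standing assumption: two different bilevel feasible paths (of the same commodity) have different initial costs. Path enumeration algorithm (input: $G$, $o^k,d^k$, $c$, and a maximum number $N$ of paths). Each candidate path $q$ carries a spur node $s(q)$ and a set $R(q)\subseteq A_1$ of excluded tolled arcs. $C$ is the set of candidates. 1. Find a shortest path $p^{(1)}$ from $o^k$ to $d^k$ in $G$; set $C=\{p^{(1)}\}$, $s(p^{(1)})=o^k$, $R(p^{(1)})=\varnothing$,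 $j=1$. 2. While $j\le N$ (and $C\ne\varnothing$): output a path of minimum cost in $C$, call it $p^{(j)}$, and remove it from $C$. If $p^{(j)}$ has no tolled arcs, stop the algorithm. Otherwise let $a_1,\dots,a_m$ be the tolled arcs of $p^{(j)}$ lying between $s(p^{(j)})$ and $d^k$, in order of appearance, and set $\hat s=s(p^{(j)})$. For $i=1,\dots,m$: let $q^i$ be the subpath of $p^{(j)}$ from $o^k$ to $\hat s$; set $s(q^i)=\hat s$ and $R(q^i)=R(p^{(j)})\cup\{a_i\}$; in $G$ with the nodes of $q^i$ preceding $\hat s$ and the arcs of $R(q^i)$ removed (for this iteration only), if $d^k$ is reachable from $\hat s$, append to $q^i$ a shortest path from $\hat s$ to $d^k$ and add the resulting path $q^i$ to $C$; then set $\hat s$ to be the target (head) of $a_i$. After the for loop, increase $j$ by 1. Ties are broken arbitrarily. *)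

theory Defs
  imports Complex_Main "Graph_Theory.Digraph_Component"
begin

text \<open>
  A path is its list of arcs. Graphs are finite digraphs of the Graph Theory library, in which
  parallel arcs and loops are permitted; elementary paths are the library's \<^const>\<open>pre_digraph.apath\<close>.
\<close>

definition paths :: "('v, 'a) pre_digraph \<Rightarrow> 'v \<Rightarrow> 'v \<Rightarrow> 'a list set" where
  "paths G u v = {p. pre_digraph.apath G u p v}"

definition uses :: "'a list \<Rightarrow> 'a \<Rightarrow> real" where
  "uses p a = (if a \<in> set p then 1 else 0)"

definition init_cost :: "('v, 'a) pre_digraph \<Rightarrow> ('a \<Rightarrow> real) \<Rightarrow> 'a list \<Rightarrow> real" where
  "init_cost G c p = (\<Sum>a\<in>arcs G. uses p a * c a)"

definition toll_free :: "'a set \<Rightarrow> 'a list \<Rightarrow> bool" where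
  "toll_free A1 p \<longleftrightarrow> (\<forall>a\<in>set p. a \<notin> A1)"

definition bilevel_feasible ::
    "('v, 'a) pre_digraph \<Rightarrow> 'a set \<Rightarrow> ('a \<Rightarrow> real) \<Rightarrow> 'v \<Rightarrow> 'v \<Rightarrow> 'a list \<Rightarrow> bool" where
  "bilevel_feasible G A1 c u v p \<longleftrightarrow> p \<in> paths G u v \<and>
     (\<exists>T :: 'a \<Rightarrow> real. (\<forall>a\<in>A1. T a \<ge> 0) \<and>
        (\<forall>q\<in>paths G u v.
           (\<Sum>a\<in>arcs G. uses p a * c a) + (\<Sum>a\<in>A1. uses p a * T a)
           \<le> (\<Sum>a\<in>arcs G. uses q a * c a) + (\<Sum>a\<in>A1. uses q a * T a)))"

definition shortest_path ::
    "('v, 'a) pre_digraph \<Rightarrow> ('a \<Rightarrow> real) \<Rightarrow> 'v \<Rightarrow> 'a list \<Rightarrow> 'v \<Rightarrow> bool" where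
  "shortest_path G c u p v \<longleftrightarrow> p \<in> paths G u v \<and>
     (\<forall>q\<in>paths G u v. init_cost G c p \<le> init_cost G c q)"

definition remove :: "('v, 'a) pre_digraph \<Rightarrow> 'v set \<Rightarrow> 'a set \<Rightarrow> ('v, 'a) pre_digraph" where
  "remove G U R = (let H = G \<restriction> (verts G - U) in H\<lparr>arcs := arcs H - R\<rparr>)"

record ('v, 'a) candidate =
  route :: "'a list"
  spur :: 'v
  excluded :: "'a set"

text \<open>
  An elementary path leaves each of its nodes by at most one arc, so the arcs before a node \<open>s\<close> of
  the path are those preceding the arc with tail \<open>s\<close> (all arcs if \<open>s\<close> is the end of the path), and
  the nodes before \<open>s\<close> are the tails of these arcs.
\<close>

definition subpath_to :: "('v, 'a) pre_digraph \<Rightarrow> 'a list \<Rightarrow> 'v \<Rightarrow> 'a list" where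
  "subpath_to G p s = takeWhile (\<lambda>a. tail G a \<noteq> s) p"

definition subpath_from :: "('v, 'a) pre_digraph \<Rightarrow> 'a list \<Rightarrow> 'v \<Rightarrow> 'a list" where
  "subpath_from G p s = dropWhile (\<lambda>a. tail G a \<noteq> s) p"

definition spur_graph ::
    "('v, 'a) pre_digraph \<Rightarrow> 'a list \<Rightarrow> 'a set \<Rightarrow> ('v, 'a) pre_digraph" where
  "spur_graph G q R = remove G (tail G ` set q) R"

text \<open>
  The for loop for an output path \<open>p\<close> with excluded arcs \<open>R\<close> and destination \<open>v\<close>:
  \<open>branch G c v p R s as C C'\<close> means that, with current spur node \<open>s\<close> and tolled arcs \<open>as\<close> left to
  process, the candidate set \<open>C\<close> can become \<open>C'\<close>. Being a relation, it admits every choice of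
  shortest path in case of ties.
\<close>

inductive branch ::
    "('v, 'a) pre_digraph \<Rightarrow> ('a \<Rightarrow> real) \<Rightarrow> 'v \<Rightarrow> 'a list \<Rightarrow> 'a set \<Rightarrow> 'v \<Rightarrow> 'a list
      \<Rightarrow> ('v, 'a) candidate set \<Rightarrow> ('v, 'a) candidate set \<Rightarrow> bool"
  for G c v p R where
  finish: "branch G c v p R s [] C C"
| add: "\<lbrakk>q = subpath_to G p s; H = spur_graph G q (insert a R);
        s \<rightarrow>\<^sup>*\<^bsub>H\<^esub> v; shortest_path H c s r v;
        branch G c v p R (head G a) as
          (insert \<lparr>route = q @ r, spur = s, excluded = insert a R\<rparr> C) C'\<rbrakk>
      \<Longrightarrow> branch G c v p R s (a # as) C C'"
| skip: "\<lbrakk>q = subpath_to G p s; H = spur_graph G q (insert a R);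
        \<not> s \<rightarrow>\<^sup>*\<^bsub>H\<^esub> v;
        branch G c v p R (head G a) as C C'\<rbrakk>
      \<Longrightarrow> branch G c v p R s (a # as) C C'"

definition cheapest ::
    "('v, 'a) pre_digraph \<Rightarrow> ('a \<Rightarrow> real) \<Rightarrow> ('v, 'a) candidate set \<Rightarrow> ('v, 'a) candidate \<Rightarrow> bool"
  where
  "cheapest G c C x \<longleftrightarrow> x \<in> C \<and> (\<forall>y\<in>C. init_cost G c (route x) \<le> init_cost G c (route y))"

text \<open>
  \<open>enum_loop G A1 c v N j C ps\<close>: the while loop, entered with counter \<open>j\<close> and candidate set \<open>C\<close>,
  can output the list \<open>ps\<close> (in this order) until it ends.
\<close>

inductive enum_loop ::
    "('v, 'a) pre_digraph \<Rightarrow> 'a set \<Rightarrow> ('a \<Rightarrow> real) \<Rightarrow> 'v \<Rightarrow> nat \<Rightarrow> nat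
      \<Rightarrow> ('v, 'a) candidate set \<Rightarrow> 'a list list \<Rightarrow> bool"
  for G A1 c v N where
  limit: "\<not> j \<le> N \<Longrightarrow> enum_loop G A1 c v N j C []"
| exhausted: "enum_loop G A1 c v N j {} []"
| stop: "\<lbrakk>j \<le> N; cheapest G c C x; toll_free A1 (route x)\<rbrakk>
      \<Longrightarrow> enum_loop G A1 c v N j C [route x]"
| continue: "\<lbrakk>j \<le> N; cheapest G c C x; \<not> toll_free A1 (route x);
        branch G c v (route x) (excluded x) (spur x)
          (filter (\<lambda>a. a \<in> A1) (subpath_from G (route x) (spur x))) (C - {x}) C';
        enum_loop G A1 c v N (Suc j) C' ps\<rbrakk>
      \<Longrightarrow> enum_loop G A1 c v N j C (route x # ps)"

definition path_enumeration ::
    "('v, 'a) pre_digraph \<Rightarrow> 'a set \<Rightarrow> ('a \<Rightarrow> real) \<Rightarrow> 'v \<Rightarrow> 'v \<Rightarrow> nat \<Rightarrow> 'a list list \<Rightarrow> bool" where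
  "path_enumeration G A1 c u v N ps \<longleftrightarrow>
     (\<exists>p. shortest_path G c u p v \<and>
        enum_loop G A1 c v N 1 {\<lparr>route = p, spur = u, excluded = {}\<rparr>} ps)"

text \<open>Every partial run can be completed, so quantifying over all runs is never vacuous.\<close>

lemma shortest_path_exists:
  assumes "fin_digraph G" "paths G u v \<noteq> {}"
  shows "\<exists>p. shortest_path G c u p v"
proof -
  interpret fin_digraph G by fact
  have "finite (paths G u v)" unfolding paths_def by (rule apaths_finite)
  then show ?thesis
    using ex_min_if_finite[of "init_cost G c ` paths G u v"] assms(2)
    unfolding shortest_path_def by (force simp: not_less)
qed

lemma fin_digraph_spur_graph:
  assumes "fin_digraph G"
  shows "fin_digraph (spur_graph G q R)"
proof -
  interpret fin_digraph G by fact
  show ?thesis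
    by unfold_locales (auto simp: spur_graph_def remove_def Let_def)
qed

lemma branch_total:
  assumes "fin_digraph G" "finite C"
  shows "\<exists>C'. branch G c v p R s as C C' \<and> finite C'"
  using assms(2)
proof (induction as arbitrary: s C)
  case Nil
  then show ?case by (auto intro: branch.finish)
next
  case (Cons a as)
  define H where "H = spur_graph G (subpath_to G p s) (insert a R)"
  interpret H: fin_digraph H
    unfolding H_def by (rule fin_digraph_spur_graph[OF assms(1)])
  show ?case
  proof (cases "s \<rightarrow>\<^sup>*\<^bsub>H\<^esub> v")
    case True
    then have "paths H s v \<noteq> {}" by (auto simp: paths_def H.reachable_apath)
    then obtain r where "shortest_path H c s r v"
      using shortest_path_exists[OF H.fin_digraph] by blast
    then show ?thesis
      using branch.add[OF refl H_def True] Cons by (meson finite_insert)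
  next
    case False
    then show ?thesis using branch.skip[OF refl H_def] Cons by meson
  qed
qed

lemma enum_loop_total:
  assumes "fin_digraph G" "finite C"
  shows "\<exists>ps. enum_loop G A1 c v N j C ps"
  using assms(2)
proof (induction "Suc N - j" arbitrary: j C)
  case 0
  then have "\<not> j \<le> N" by simp
  then show ?case by (blast intro: enum_loop.limit)
next
  case (Suc n)
  show ?case
  proof (cases "C = {}")
    case False
    have j: "j \<le> N" using Suc.hyps(2) by simp
    obtain x where x: "cheapest G c C x"
      using ex_min_if_finite[of "(\<lambda>y. init_cost G c (route y)) ` C"] False Suc.prems
      unfolding cheapest_def by (force simp: not_less)
    obtain C' where C': "finite C'"
      "branch G c v (route x) (excluded x) (spur x)
         (filter (\<lambda>a. a \<in> A1) (subpath_from G (route x) (spur x))) (C - {x}) C'"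
      using branch_total[OF assms(1)] Suc.prems by (metis finite_Diff)
    obtain ps where "enum_loop G A1 c v N (Suc j) C' ps"
      using Suc.hyps(1)[of "Suc j" C'] Suc.hyps(2) C'(1) j by fastforce
    then show ?thesis
      using enum_loop.stop[OF j x] enum_loop.continue[OF j x _ C'(2)] by blast
  qed (blast intro: enum_loop.exhausted)
qed

lemma path_enumeration_total:
  assumes "fin_digraph G" "paths G u v \<noteq> {}"
  shows "\<exists>ps. path_enumeration G A1 c u v N ps"
  using shortest_path_exists[OF assms] enum_loop_total[OF assms(1)]
  unfolding path_enumeration_def by (meson finite.emptyI finite.insertI)

end

theory Submission
  imports Defs
begin

text \<open>
  Fix a commodity with origin \<open>u\<close> and destination \<open>v\<close>. The proof rests on one rigidity property of a
  bilevel feasible path \<open>q\<close>: no other walk from \<open>u\<close> to \<open>v\<close> whose tolled arcs all lie on \<open>q\<close> is at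
  most as cheap as \<open>q\<close> (\<open>feasible_unique_walk\<close>). Indeed, under tolls that make \<open>q\<close> optimal such
  a path pays no more than \<open>q\<close>, so it is optimal too, has the same initial cost, and equals \<open>q\<close>
  because feasible paths have different costs. Shortening a walk to a path makes it strictly cheaper,
  so this extends from paths to walks.

  A candidate stands for a region: the paths that start with its prefix up to the spur node and
  then avoid its excluded arcs. Its route is a cheapest path of that region. When the route \<open>p\<close> is
  output, let a feasible \<open>q\<close> of the region follow \<open>p\<close> up to the current spur node, and let \<open>a\<close> be
  the next tolled arc of \<open>p\<close>. If \<open>q\<close> avoids \<open>a\<close> from there on, it lies in the region of the new
  candidate. If \<open>q\<close> uses \<open>a\<close>, replace the segment of \<open>q\<close> before \<open>a\<close> by the corresponding segment
  of \<open>p\<close>, which is toll-free and, as part of a shortest path, no more expensive: by rigidity nothing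
  changes, so \<open>q\<close> follows \<open>p\<close> through \<open>a\<close> (\<open>feasible_follows_shortest_segment\<close>). If \<open>q\<close> follows
  \<open>p\<close> through its last tolled arc, rigidity gives \<open>q = p\<close>. Hence every feasible path not yet
  output stays in the region of some candidate (\<open>branch_covers\<close>).

  The loop can end in three ways. If a toll-free route is output, it is at most as expensive as every
  feasible path still waiting in a region, hence equal to it by rigidity. If there are no candidates
  left, no feasible path is waiting. The limit \<open>N\<close> is harmless once \<open>N \<ge> (n + 1)\<^sup>n\<close>, where \<open>n\<close> is
  the number of tolled arcs: each new candidate excludes one more arc than its parent, and a parent
  has at most \<open>n\<close> children, so giving weight \<open>(n + 1)\<^sup>m\<close> to a candidate with \<open>m\<close> tolled arcs not
  yet excluded makes the total weight decrease in every round (\<open>branch_weight_decreases\<close>).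
\<close>

section \<open>Walks and their costs\<close>

abbreviation walk_cost :: "('a \<Rightarrow> real) \<Rightarrow> 'a list \<Rightarrow> real" where
  "walk_cost c p \<equiv> sum_list (map c p)"

text \<open>
  The tails of the arcs of a path are its nodes before the last one, exactly the nodes that the
  spur graph deletes. Hence a path can be continued elementarily by precisely those paths that
  avoid these tails; the next two lemmas are the two directions.
\<close>

lemma (in wf_digraph) apath_append_disjoint:
  assumes "apath u p s" "apath s q v" "set (awalk_verts s q) \<inter> tail G ` set p = {}"
  shows "apath u (p @ q) v"
proof -
  have w: "awalk u p s" "awalk u (p @ q) v"
    using assms by (auto simp: apath_def)
  then have "awlast u p = s" by auto
  then have "awalk_verts u (p @ q) = map (tail G) p @ awalk_verts s q"
    using w by (simp add: awalk_verts_append2) (auto simp: awalk_verts_conv)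
  moreover have "distinct (map (tail G) p)"
    using assms(1) by (auto simp: apath_def awalk_verts_conv split: if_splits)
  ultimately show ?thesis
    using w assms by (auto simp: apath_def)
qed

lemma (in wf_digraph) apath_suffix_disjoint:
  assumes "apath u (p @ q) v" "awalk u p s"
  shows "apath s q v" "set (awalk_verts s q) \<inter> tail G ` set p = {}"
proof -
  have s: "awlast u p = s" using assms(2) by auto
  then show "apath s q v" using assms(1) by (simp add: apath_append_iff)
  have "awalk_verts u (p @ q) = map (tail G) p @ awalk_verts s q"
    using assms s by (simp add: awalk_verts_append2 apath_def) (auto simp: awalk_verts_conv)
  then show "set (awalk_verts s q) \<inter> tail G ` set p = {}"
    using assms(1) by (auto simp: apath_def)
qed

lemma (in wf_digraph) awalk_exchange_segment:
  assumes "awalk u (w @ x @ a # y) v" "awalk u (w @ z @ a # y') v'"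
  shows "awalk u (w @ z @ a # y) v"
  using assms by (auto simp: awalk_def)

text \<open>
  The strict inequality is the point: each cycle that is cut out has positive cost. It lets a walk
  be identified with a path as soon as their costs agree.
\<close>

lemma (in wf_digraph) awalk_shortcut:
  assumes "awalk u w v" and pos: "\<forall>a\<in>arcs G. 0 < (c a :: real)"
  obtains p where "apath u p v" "set p \<subseteq> set w" "p = w \<or> walk_cost c p < walk_cost c w"
proof -
  have "\<exists>p. apath u p v \<and> set p \<subseteq> set w \<and> (p = w \<or> walk_cost c p < walk_cost c w)"
    using assms(1)
  proof (induction "length w" arbitrary: w rule: less_induct)
    case less
    show ?case
    proof (cases "distinct (awalk_verts u w)")
      case True
      then show ?thesis using less.prems by (auto simp: apath_def)
    next
      case False
      obtain x y z m where w: "w = x @ y @ z" "y \<noteq> []"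
        and m: "awalk u x m" "awalk m y m" "awalk m z v"
        using awalk_not_distinct_decomp[OF less.prems False] by auto
      have "0 < walk_cost c y"
      proof -
        obtain a y' where y: "y = a # y'" using w by (cases y) auto
        have "0 \<le> walk_cost c y'"
          by (rule sum_list_nonneg) (use m(2) y pos in \<open>force simp: awalk_def\<close>)
        moreover have "0 < c a" using m(2) y pos by (simp add: awalk_def)
        ultimately show ?thesis using y by simp
      qed
      moreover have "awalk u (x @ z) v" using m by auto
      ultimately show ?thesis
        using less.hyps[of "x @ z"] w by fastforce
    qed
  qed
  then show ?thesis using that by blast
qed

lemma (in fin_digraph) init_cost_path:
  assumes "p \<in> paths G u v"
  shows "init_cost G c p = walk_cost c p"
proof -
  have p: "set p \<subseteq> arcs G" "distinct p"
    using assms distinct_verts_imp_distinct by (auto simp: paths_def apath_def)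
  have "init_cost G c p = (\<Sum>a\<in>arcs G. if a \<in> set p then c a else 0)"
    by (auto simp: init_cost_def uses_def intro: sum.cong)
  also have "\<dots> = sum c (arcs G \<inter> set p)" by (simp add: sum.inter_restrict)
  also have "arcs G \<inter> set p = set p" using p by auto
  finally show ?thesis using p by (simp add: sum_list_distinct_conv_sum_set)
qed

lemma (in fin_digraph) shortest_path_le_walk:
  assumes "shortest_path G c u p v" "awalk u w v" and pos: "\<forall>a\<in>arcs G. 0 < c a"
  shows "walk_cost c p \<le> walk_cost c w"
proof -
  obtain q where q: "apath u q v" "set q \<subseteq> set w" "q = w \<or> walk_cost c q < walk_cost c w"
    by (rule awalk_shortcut[OF assms(2) pos])
  then have "init_cost G c p \<le> init_cost G c q"
    using assms(1) by (auto simp: shortest_path_def paths_def)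
  then show ?thesis
    using q init_cost_path[of _ u v c] assms(1) by (auto simp: shortest_path_def paths_def)
qed


section \<open>Paths in the spur graph\<close>

lemma spur_graph_sel:
  "verts (spur_graph G p R) = verts G - tail G ` set p"
  "arcs (spur_graph G p R) = {a \<in> arcs G. {tail G a, head G a} \<subseteq> verts G - tail G ` set p} - R"
  "tail (spur_graph G p R) = tail G"
  "head (spur_graph G p R) = head G"
  by (auto simp: spur_graph_def remove_def Let_def)

lemma awalk_verts_spur_graph:
  "pre_digraph.awalk_verts (spur_graph G p R) s q = pre_digraph.awalk_verts G s q"
  by (induction q arbitrary: s) (auto simp: pre_digraph.awalk_verts.simps spur_graph_sel)

lemma (in fin_digraph) apath_spur_graph:
  "pre_digraph.apath (spur_graph G p R) s q v \<longleftrightarrow>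
     apath s q v \<and> set (awalk_verts s q) \<inter> tail G ` set p = {} \<and> set q \<inter> R = {}"
proof -
  interpret H: fin_digraph "spur_graph G p R"
    by (rule fin_digraph_spur_graph) (rule fin_digraph)
  show ?thesis
  proof (induction q arbitrary: s)
    case Nil
    then show ?case by (auto simp: H.apath_Nil_iff apath_Nil_iff spur_graph_sel)
  next
    case (Cons a q)
    have "head G a \<in> set (awalk_verts (head G a) q)" if "apath (head G a) q v"
      using that by (meson apath_def hd_in_awalk_verts(1))
    then show ?case
      by (auto simp: H.apath_Cons_iff apath_Cons_iff Cons awalk_verts_spur_graph spur_graph_sel)
  qed
qed

text \<open>
  Searching the spur graph amounts to searching all elementary paths of \<open>G\<close> that extend the fixed
  prefix and avoid the excluded arcs afterwards.
\<close>

lemma (in fin_digraph) paths_spur_graph: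
  assumes "apath u p s"
  shows "q \<in> paths (spur_graph G p R) s v \<longleftrightarrow> p @ q \<in> paths G u v \<and> set q \<inter> R = {}"
proof
  assume "q \<in> paths (spur_graph G p R) s v"
  then show "p @ q \<in> paths G u v \<and> set q \<inter> R = {}"
    using apath_append_disjoint[OF assms] by (auto simp: paths_def apath_spur_graph)
next
  assume "p @ q \<in> paths G u v \<and> set q \<inter> R = {}"
  then show "q \<in> paths (spur_graph G p R) s v"
    using apath_suffix_disjoint[of u p q v s] assms
    by (auto simp: paths_def apath_spur_graph apath_def)
qed

lemma (in fin_digraph) subpath_append:
  assumes "p @ q \<in> paths G u v" "awalk u p s"
  shows "subpath_to G (p @ q) s = p" "subpath_from G (p @ q) s = q"
proof -
  have q: "awalk s q v" "set (awalk_verts s q) \<inter> tail G ` set p = {}"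
    using apath_suffix_disjoint[of u p q v s] assms by (auto simp: paths_def apath_def)
  then have "s \<in> set (awalk_verts s q)" by (auto simp: set_awalk_verts)
  then have p: "\<forall>a\<in>set p. tail G a \<noteq> s" using q by auto
  have hd: "q = [] \<or> tail G (hd q) = s" using q by (cases q) (auto simp: awalk_Cons_iff)
  show "subpath_to G (p @ q) s = p" "subpath_from G (p @ q) s = q"
    unfolding subpath_to_def subpath_from_def using p hd by (cases q; auto)+
qed


section \<open>Bilevel feasible paths\<close>

locale toll_network = fin_digraph G
  for G :: "('v, 'a) pre_digraph" +
  fixes A1 :: "'a set" and c :: "'a \<Rightarrow> real" and u v :: 'v
  assumes tolled_arcs: "A1 \<subseteq> arcs G"
    and cost_pos: "\<forall>a\<in>arcs G. 0 < c a"
    and distinct_costs: "\<lbrakk>bilevel_feasible G A1 c u v p; bilevel_feasible G A1 c u v q;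
          init_cost G c p = init_cost G c q\<rbrakk> \<Longrightarrow> p = q"
begin

abbreviation feasible :: "'a list \<Rightarrow> bool" where
  "feasible \<equiv> bilevel_feasible G A1 c u v"

lemma finite_tolled: "finite A1"
  using tolled_arcs finite_arcs finite_subset by blast

text \<open>
  Tolls \<open>T\<close> that support \<open>q\<close> also support \<open>p\<close>, since \<open>p\<close> costs no more and pays tolls only on arcs
  of \<open>q\<close>. So \<open>p\<close> is feasible as well, both inequalities are tight, and different feasible paths
  do not have equal costs.
\<close>

lemma feasible_unique_path:
  assumes q: "feasible q" and p: "p \<in> paths G u v"
    and tolls: "set p \<inter> A1 \<subseteq> set q" and cost: "walk_cost c p \<le> walk_cost c q"
  shows "p = q"
proof -
  obtain T where T: "\<forall>a\<in>A1. T a \<ge> (0 :: real)"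
    and opt: "\<forall>r\<in>paths G u v. init_cost G c q + (\<Sum>a\<in>A1. uses q a * T a)
           \<le> init_cost G c r + (\<Sum>a\<in>A1. uses r a * T a)"
    using q by (auto simp: bilevel_feasible_def init_cost_def)
  have toll_le: "(\<Sum>a\<in>A1. uses p a * T a) \<le> (\<Sum>a\<in>A1. uses q a * T a)"
    using tolls T by (intro sum_mono) (auto simp: uses_def)
  have cost_le: "init_cost G c p \<le> init_cost G c q"
    using cost init_cost_path[of _ u v c] p q by (auto simp: bilevel_feasible_def)
  have "feasible p"
    unfolding bilevel_feasible_def init_cost_def[symmetric]
    using p T opt toll_le cost_le by (fastforce intro!: exI[of _ T])
  moreover have "init_cost G c p = init_cost G c q"
    using opt p toll_le cost_le by force
  ultimately show ?thesis using distinct_costs q by blast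
qed

lemma feasible_unique_walk:
  assumes q: "feasible q" and w: "awalk u w v"
    and tolls: "set w \<inter> A1 \<subseteq> set q" and cost: "walk_cost c w \<le> walk_cost c q"
  shows "w = q"
proof -
  obtain p where p: "apath u p v" "set p \<subseteq> set w" "p = w \<or> walk_cost c p < walk_cost c w"
    by (rule awalk_shortcut[OF w cost_pos])
  moreover have "set p \<inter> A1 \<subseteq> set q" using p tolls by blast
  ultimately have "p = q"
    using feasible_unique_path[OF q, of p] cost by (auto simp: paths_def)
  then show ?thesis using p cost by auto
qed

text \<open>
  Why excluding \<open>a\<close> only at the current spur node loses nothing: a feasible path cannot reach \<open>a\<close> by
  another way than the shortest path does. The segments \<open>x\<close> and \<open>z\<close> are exchanged twice. Inserting
  \<open>z\<close> into the shortest path gives a walk of the spur graph, whence \<open>x\<close> is no more expensive than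
  \<open>z\<close>; inserting the toll-free \<open>x\<close> into \<open>q\<close> then gives a walk that must be \<open>q\<close> itself. Neither
  walk need be elementary.
\<close>

lemma feasible_follows_shortest_segment:
  assumes short: "shortest_path (spur_graph G p R) c s (w @ x @ a # y) v"
    and p: "apath u p s"
    and q: "feasible q" "q = p @ w @ z @ a # y'" "set (w @ z @ a # y') \<inter> R = {}"
    and free: "set x \<inter> A1 = {}"
  shows "x = z"
proof -
  define H where "H = spur_graph G p R"
  interpret H: fin_digraph H
    unfolding H_def by (rule fin_digraph_spur_graph) (rule fin_digraph)
  have H_paths: "w @ x @ a # y \<in> paths H s v" "w @ z @ a # y' \<in> paths H s v"
    using short q paths_spur_graph[OF p]
    by (auto simp: shortest_path_def bilevel_feasible_def H_def)
  then have "H.awalk s (w @ z @ a # y) v"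
    using H.awalk_exchange_segment[of s w x a y v z y' v] unfolding paths_def H.apath_def by blast
  then have le: "walk_cost c x \<le> walk_cost c z"
    using H.shortest_path_le_walk[of c s "w @ x @ a # y" v "w @ z @ a # y"] short cost_pos
    by (auto simp: H_def spur_graph_sel)
  have "awalk u ((p @ w) @ x @ a # y') v"
    using awalk_exchange_segment[of u "p @ w" z a y' v x y v] H_paths q paths_spur_graph[OF p]
    unfolding paths_def apath_def H_def by fastforce
  then have "(p @ w) @ x @ a # y' = q"
    by (rule feasible_unique_walk[OF q(1)]) (use q free le in auto)
  then show ?thesis using q by simp
qed


section \<open>Branching loses no feasible path\<close>

text \<open>
  What holds of every candidate ever created: it was built by extending a prefix by a shortest path of
  the spur graph.
\<close>

definition valid :: "('v, 'a) candidate \<Rightarrow> bool" where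
  "valid x \<longleftrightarrow> (\<exists>p r. route x = p @ r \<and> apath u p (spur x) \<and>
     shortest_path (spur_graph G p (excluded x)) c (spur x) r v)"

text \<open>
  The paths that a candidate stands for; the route of a valid candidate is a cheapest one among them.
\<close>

definition region :: "('v, 'a) candidate \<Rightarrow> 'a list set" where
  "region x = {q \<in> paths G u v. \<exists>t. q = subpath_to G (route x) (spur x) @ t \<and>
     set t \<inter> excluded x = {}}"

lemma validE:
  assumes "valid x"
  obtains p r where "route x = p @ r" "p @ r \<in> paths G u v" "apath u p (spur x)"
    "shortest_path (spur_graph G p (excluded x)) c (spur x) r v" "set r \<inter> excluded x = {}"
    "subpath_to G (route x) (spur x) = p" "subpath_from G (route x) (spur x) = r"
proof -
  obtain p r where pr: "route x = p @ r" "apath u p (spur x)"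
    "shortest_path (spur_graph G p (excluded x)) c (spur x) r v"
    using assms by (auto simp: valid_def)
  then have "p @ r \<in> paths G u v" "set r \<inter> excluded x = {}"
    using paths_spur_graph[OF pr(2)] by (auto simp: shortest_path_def)
  with pr show ?thesis
    using that subpath_append[of p r u v "spur x"] by (auto simp: apath_def)
qed

lemma valid_route_cheapest:
  assumes "valid x" "q \<in> region x"
  shows "walk_cost c (route x) \<le> walk_cost c q"
proof -
  obtain p r where x: "route x = p @ r" "p @ r \<in> paths G u v" "apath u p (spur x)"
    "shortest_path (spur_graph G p (excluded x)) c (spur x) r v"
    "subpath_to G (route x) (spur x) = p"
    using validE[OF assms(1)] by metis
  obtain t where t: "q = p @ t" "p @ t \<in> paths G u v" "set t \<inter> excluded x = {}"
    using assms(2) x by (auto simp: region_def)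
  interpret H: fin_digraph "spur_graph G p (excluded x)"
    by (rule fin_digraph_spur_graph) (rule fin_digraph)
  have "t \<in> paths (spur_graph G p (excluded x)) (spur x) v"
    using t paths_spur_graph[OF x(3)] by blast
  then have "H.awalk (spur x) t v" by (simp add: paths_def H.apath_def)
  then have "walk_cost c r \<le> walk_cost c t"
    using H.shortest_path_le_walk[OF x(4)] cost_pos by (auto simp: spur_graph_sel)
  then show ?thesis using t x by simp
qed

lemma branch_mono: "branch G c v p R s as C C' \<Longrightarrow> C \<subseteq> C'"
  by (induction rule: branch.induct) auto

lemma first_toll_split:
  assumes "filter (\<lambda>a. a \<in> A1) r = a # as"
  obtains x y where "r = x @ a # y" "set x \<inter> A1 = {}" "filter (\<lambda>a. a \<in> A1) y = as"
  using assms by (auto simp: filter_eq_Cons_iff)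

lemma apath_prefix_to_arc:
  assumes "p @ x @ a # y \<in> paths G u v"
  shows "apath u (p @ x @ [a]) (head G a)"
proof -
  have "apath u ((p @ x @ [a]) @ y) v" using assms by (simp add: paths_def)
  then have "apath u (p @ x @ [a]) (awlast u (p @ x @ [a]))"
    unfolding apath_append_iff[of u "p @ x @ [a]"] by blast
  then show ?thesis by (simp add: awalk_verts_conv)
qed

lemma branch_valid:
  assumes "branch G c v p R s as C C'" "p \<in> paths G u v"
    "p = p0 @ rest" "apath u p0 s" "as = filter (\<lambda>a. a \<in> A1) rest"
    "\<forall>x\<in>C. valid x"
  shows "\<forall>x\<in>C'. valid x"
  using assms
proof (induction arbitrary: p0 rest rule: branch.induct)
  case (finish s C)
  then show ?case by simp
next
  case (add q s H a r as C C')
  obtain x y where xy: "rest = x @ a # y" "filter (\<lambda>a. a \<in> A1) y = as"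
    using first_toll_split[of rest a as] add.prems(4) by metis
  have q: "q = p0"
    using add.hyps(1) add.prems subpath_append[of p0 rest u v s] by (auto simp: apath_def)
  have "valid \<lparr>route = q @ r, spur = s, excluded = insert a R\<rparr>"
    using add q by (auto simp: valid_def)
  moreover have "apath u (p0 @ x @ [a]) (head G a)"
    using apath_prefix_to_arc add.prems xy by blast
  ultimately show ?case
    using add.IH[of "p0 @ x @ [a]" y] add.prems xy by auto
next
  case (skip q s H a as C C')
  obtain x y where xy: "rest = x @ a # y" "filter (\<lambda>a. a \<in> A1) y = as"
    using first_toll_split[of rest a as] skip.prems(4) by metis
  moreover have "apath u (p0 @ x @ [a]) (head G a)"
    using apath_prefix_to_arc skip.prems xy by blast
  ultimately show ?case
    using skip.IH[of "p0 @ x @ [a]" y] skip.prems by auto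
qed

text \<open>
  The prefix \<open>p0\<close> belongs to the spur node \<open>s0\<close> at which the output path \<open>p\<close> was created, and \<open>w\<close>
  is the part of \<open>p\<close> that the loop has passed since. Shortness is known only for all of \<open>p\<close> after
  \<open>s0\<close>, in the graph spurred at \<open>s0\<close>, so both prefixes have to be carried along.
\<close>

lemma branch_covers:
  assumes "branch G c v p R s as C C'"
    and "apath u p0 s0" "p = p0 @ w @ rest" "apath u (p0 @ w) s"
    and "shortest_path (spur_graph G p0 R) c s0 (w @ rest) v"
    and "as = filter (\<lambda>a. a \<in> A1) rest"
    and "feasible q" "q = p0 @ w @ t" "set (w @ t) \<inter> R = {}"
  shows "q = p \<or> (\<exists>x\<in>C'. q \<in> region x)"
  using assms
proof (induction arbitrary: w rest t rule: branch.induct)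
  case (finish s C)
  interpret H: fin_digraph "spur_graph G p0 R"
    by (rule fin_digraph_spur_graph) (rule fin_digraph)
  have q: "q \<in> paths G u v" using finish by (simp add: bilevel_feasible_def)
  then have "w @ t \<in> paths (spur_graph G p0 R) s0 v"
    using finish paths_spur_graph[of u p0 s0 "w @ t"] by simp
  then have "walk_cost c (w @ rest) \<le> walk_cost c (w @ t)"
    using H.shortest_path_le_walk[OF finish(4), of "w @ t"] cost_pos
    by (simp add: spur_graph_sel paths_def H.apath_def del: H.awalk_append_iff)
  moreover have "p \<in> paths G u v"
    using finish paths_spur_graph[of u p0 s0 "w @ rest" R] by (auto simp: shortest_path_def)
  moreover have "set rest \<inter> A1 = {}" using finish(5)[symmetric] by (auto simp: filter_empty_conv)
  \<comment> \<open>The tolled arcs of \<open>p\<close> all lie on the part that it shares with \<open>q\<close>.\<close>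
  ultimately have "p = q"
    using finish by (intro feasible_unique_path) auto
  then show ?case by simp
next
  case (add q' s H a r as C C')
  have p: "p \<in> paths G u v"
    using add.prems paths_spur_graph[of u p0 s0 "w @ rest" R] by (auto simp: shortest_path_def)
  obtain x y where xy: "rest = x @ a # y" "set x \<inter> A1 = {}" "filter (\<lambda>a. a \<in> A1) y = as"
    using first_toll_split[of rest a as] add.prems(5) by metis
  have q': "q' = p0 @ w"
    using add.hyps(1) add.prems p subpath_append[of "p0 @ w" rest u v s] by (auto simp: apath_def)
  show ?case
  proof (cases "a \<in> set t")
    case True
    then obtain z y' where t: "t = z @ a # y'" by (auto simp: in_set_conv_decomp)
    have "x = z"
      using feasible_follows_shortest_segment[of p0 R s0 w x a y q z y'] add.prems xy t by simp
    moreover have "apath u (p0 @ w @ x @ [a]) (head G a)"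
      using apath_prefix_to_arc[of "p0 @ w" x a y] add.prems xy p by simp
    ultimately show ?thesis
      using add.IH[of "w @ x @ [a]" y y'] add.prems xy t by simp
  next
    case False
    let ?x = "\<lparr>route = q' @ r, spur = s, excluded = insert a R\<rparr>"
    have "r \<in> paths (spur_graph G (p0 @ w) (insert a R)) s v"
      using add.hyps q' by (simp add: shortest_path_def)
    then have "subpath_to G (q' @ r) s = q'"
      using q' add.prems(3) paths_spur_graph[OF add.prems(3)] subpath_append[of "p0 @ w" r u v s]
      by (auto simp: apath_def)
    then have "q \<in> region ?x"
      using add.prems False q' by (auto simp: region_def bilevel_feasible_def)
    then show ?thesis using branch_mono[OF add.hyps(5)] by auto
  qed
next
  case (skip q' s H a as C C')
  have p: "p \<in> paths G u v"
    using skip.prems paths_spur_graph[of u p0 s0 "w @ rest" R] by (auto simp: shortest_path_def)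
  obtain x y where xy: "rest = x @ a # y" "set x \<inter> A1 = {}" "filter (\<lambda>a. a \<in> A1) y = as"
    using first_toll_split[of rest a as] skip.prems(5) by metis
  have q': "q' = p0 @ w"
    using skip.hyps(1) skip.prems p subpath_append[of "p0 @ w" rest u v s] by (auto simp: apath_def)
  interpret H: fin_digraph H
    unfolding skip.hyps(2) by (rule fin_digraph_spur_graph) (rule fin_digraph)
  \<comment> \<open>Otherwise \<open>t\<close> would connect \<open>s\<close> with \<open>v\<close> in the spur graph.\<close>
  have "a \<in> set t"
  proof (rule ccontr)
    assume "a \<notin> set t"
    then have "t \<in> paths H s v"
      using paths_spur_graph[OF skip.prems(3), of t "insert a R"] skip.prems skip.hyps(2) q'
      by (auto simp: bilevel_feasible_def)
    then show False using skip.hyps(3) H.reachable_apath by (auto simp: paths_def)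
  qed
  then obtain z y' where t: "t = z @ a # y'" by (auto simp: in_set_conv_decomp)
  have "x = z"
    using feasible_follows_shortest_segment[of p0 R s0 w x a y q z y'] skip.prems xy t by simp
  moreover have "apath u (p0 @ w @ x @ [a]) (head G a)"
    using apath_prefix_to_arc[of "p0 @ w" x a y] skip.prems xy p by simp
  ultimately show ?case
    using skip.IH[of "w @ x @ [a]" y y'] skip.prems xy t by simp
qed


section \<open>Termination\<close>

definition weight :: "('v, 'a) candidate \<Rightarrow> nat" where
  "weight x = Suc (card A1) ^ card (A1 - excluded x)"

lemma branch_weight:
  assumes "branch G c v p R s as C C'" "finite C" "set as \<subseteq> A1 - R"
  shows "finite C' \<and>
    sum weight C' \<le> sum weight C + length as * Suc (card A1) ^ (card (A1 - R) - 1)"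
  using assms
proof (induction rule: branch.induct)
  case (finish s C)
  then show ?case by simp
next
  case (add q s H a r as C C')
  let ?x = "\<lparr>route = q @ r, spur = s, excluded = insert a R\<rparr>"
  have "card (A1 - insert a R) = card (A1 - R) - 1"
    using add.prems by (metis Diff_insert card_Diff_singleton insert_subset list.set(2))
  then have "weight ?x = Suc (card A1) ^ (card (A1 - R) - 1)" by (simp add: weight_def)
  moreover have "sum weight (insert ?x C) \<le> sum weight C + weight ?x"
    using add.prems by (simp add: sum.insert_if)
  ultimately show ?case using add by auto
next
  case (skip q s H a as C C')
  then show ?case by auto
qed

text \<open>
  At most \<open>n = card A1\<close> children, each lighter than \<open>x\<close> by the factor \<open>n + 1\<close>, weigh less than
  \<open>x\<close> together.
\<close>

lemma branch_weight_decreases: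
  assumes "branch G c v p R s as (C - {x}) C'" "finite C" "x \<in> C" "excluded x = R"
    and as: "set as \<subseteq> A1 - R" "distinct as"
  shows "finite C'" "sum weight C' < sum weight C"
proof -
  define k where "k = card (A1 - R)"
  have fin: "finite (A1 - R)" using finite_tolled by simp
  have le_k: "length as \<le> k"
    using card_mono[OF fin as(1)] distinct_card[OF as(2)] by (simp add: k_def)
  moreover have "k \<le> card A1" unfolding k_def by (rule card_mono[OF finite_tolled]) auto
  ultimately have len: "length as < Suc (card A1)" by simp
  have lt: "length as * Suc (card A1) ^ (k - 1) < weight x"
  proof (cases k)
    case 0
    then show ?thesis using le_k assms(4) by (simp add: weight_def)
  next
    case (Suc l)
    have "length as * Suc (card A1) ^ l < Suc (card A1) * Suc (card A1) ^ l"
      by (rule mult_strict_right_mono[OF len]) simp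
    then show ?thesis using Suc assms(4) by (simp add: weight_def k_def)
  qed
  have b: "finite C' \<and> sum weight C' \<le> sum weight (C - {x}) + length as * Suc (card A1) ^ (k - 1)"
    unfolding k_def using branch_weight[OF assms(1)] assms by blast
  moreover have "sum weight C = weight x + sum weight (C - {x})"
    using assms by (meson sum.remove)
  ultimately show "finite C'" "sum weight C' < sum weight C" using lt by auto
qed

text \<open>
  The bound on \<open>j + sum weight C\<close> is kept by every round, since \<open>j\<close> grows by one and the weight
  drops by at least one. As each candidate has positive weight, the counter can exceed \<open>N\<close> only
  when the candidate set is empty.
\<close>

lemma enum_loop_outputs_feasible:
  assumes "enum_loop G A1 c v N j C ps" "finite C" "\<forall>x\<in>C. valid x"
    "j + sum weight C \<le> Suc N" "feasible q" "\<exists>x\<in>C. q \<in> region x"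
  shows "q \<in> set ps"
  using assms
proof (induction rule: enum_loop.induct)
  case (limit j C)
  then have "sum weight C = 0" by linarith
  then have "C = {}" using limit.prems by (auto simp: weight_def)
  then show ?case using limit.prems by simp
next
  case (exhausted j)
  then show ?case by simp
next
  case (stop j C x)
  obtain y where y: "y \<in> C" "q \<in> region y" using stop.prems by blast
  have route: "route z \<in> paths G u v" if "z \<in> C" for z
    using that stop.prems(2) by (metis validE)
  have x: "x \<in> C" using stop.hyps by (simp add: cheapest_def)
  \<comment> \<open>\<open>q\<close> waits behind a candidate at least as expensive as the toll-free route just output.\<close>
  have "walk_cost c (route x) \<le> walk_cost c (route y)"
    using stop.hyps(2) y(1) init_cost_path[OF route, of _ c] x by (simp add: cheapest_def)
  also have "\<dots> \<le> walk_cost c q"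
    using valid_route_cheapest y stop.prems by blast
  finally have "route x = q"
    using feasible_unique_path[OF stop.prems(4) route[OF x]] stop.hyps(3)
    by (auto simp: toll_free_def)
  then show ?case by simp
next
  case (continue j C x C' ps)
  have x: "x \<in> C" using continue.hyps by (simp add: cheapest_def)
  obtain p r where pr: "route x = p @ r" "p @ r \<in> paths G u v" "apath u p (spur x)"
    "shortest_path (spur_graph G p (excluded x)) c (spur x) r v" "set r \<inter> excluded x = {}"
    "subpath_to G (route x) (spur x) = p" "subpath_from G (route x) (spur x) = r"
    using validE x continue.prems by metis
  define as where "as = filter (\<lambda>a. a \<in> A1) r"
  have br: "branch G c v (route x) (excluded x) (spur x) as (C - {x}) C'"
    using continue.hyps(4) pr by (simp add: as_def)
  have new: "q = route x \<or> (\<exists>y\<in>C'. q \<in> region y)"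
  proof (cases "q \<in> region x")
    case True
    then obtain t where "q = p @ t" "set t \<inter> excluded x = {}" using pr by (auto simp: region_def)
    then show ?thesis
      using branch_covers[OF br pr(3), of "[]" r q t] pr continue.prems by (simp add: as_def)
  next
    case False
    then have "\<exists>y\<in>C - {x}. q \<in> region y" using continue.prems by blast
    then show ?thesis using branch_mono[OF br] by blast
  qed
  have d: "distinct as" "set as \<subseteq> A1 - excluded x"
    using pr distinct_verts_imp_distinct[of u "p @ r" v]
    by (auto simp: as_def paths_def apath_def)
  have "\<forall>y\<in>C'. valid y"
    by (rule branch_valid[OF br]) (use pr continue.prems in \<open>auto simp: as_def\<close>)
  moreover have "finite C'" "sum weight C' < sum weight C"
    using branch_weight_decreases[OF br _ x refl d(2,1)] continue.prems by auto
  ultimately show ?case using new continue by auto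
qed

lemma path_enumeration_outputs_feasible:
  assumes run: "path_enumeration G A1 c u v N ps"
    and N: "Suc (card A1) ^ card A1 \<le> N" and q: "feasible q"
  shows "q \<in> set ps"
proof -
  obtain p where p: "shortest_path G c u p v"
    and loop: "enum_loop G A1 c v N 1 {\<lparr>route = p, spur = u, excluded = {}\<rparr>} ps"
    using run by (auto simp: path_enumeration_def)
  let ?x = "\<lparr>route = p, spur = u, excluded = {}\<rparr> :: ('v, 'a) candidate"
  have "spur_graph G [] {} = G"
    by (rule pre_digraph.equality) (auto simp: spur_graph_sel)
  moreover have "apath u [] u"
    using p by (auto simp: shortest_path_def paths_def apath_def awalk_Nil_iff)
  ultimately have x: "valid ?x"
    using p unfolding valid_def by (intro exI[of _ "[]"] exI[of _ p]) simp
  have "subpath_to G p u = []"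
    using subpath_append[of "[]" p u v u] p \<open>apath u [] u\<close> by (auto simp: shortest_path_def apath_def)
  then have "q \<in> region ?x" using q by (simp add: region_def bilevel_feasible_def)
  then show ?thesis
    using enum_loop_outputs_feasible[OF loop] x N q by (simp add: weight_def)
qed

end

theorem theorem9:
  fixes G :: "('v, 'a) pre_digraph"
    and A1 A2 :: "'a set"
    and c :: "'a \<Rightarrow> real"
    and K :: "'k set"
    and orig dest :: "'k \<Rightarrow> 'v"
  assumes "fin_digraph G"
    and "A1 \<union> A2 = arcs G" and "A1 \<inter> A2 = {}"
    and "\<forall>a\<in>arcs G. c a > 0"
    and "\<forall>k\<in>K. orig k \<in> verts G \<and> dest k \<in> verts G"
    and "\<forall>k\<in>K. \<exists>p\<in>paths G (orig k) (dest k). toll_free A1 p"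
    and "\<forall>k\<in>K. \<forall>p q. bilevel_feasible G A1 c (orig k) (dest k) p
           \<and> bilevel_feasible G A1 c (orig k) (dest k) q \<and> p \<noteq> q
           \<longrightarrow> init_cost G c p \<noteq> init_cost G c q"
  shows "\<forall>k\<in>K. \<exists>N0. \<forall>N\<ge>N0. \<forall>ps.
           path_enumeration G A1 c (orig k) (dest k) N ps \<longrightarrow>
           (\<forall>p. bilevel_feasible G A1 c (orig k) (dest k) p \<longrightarrow> p \<in> set ps)"
proof
  fix k assume k: "k \<in> K"
  interpret fin_digraph G by fact
  interpret toll_network G A1 c "orig k" "dest k"
    by unfold_locales (use assms k in blast)+
  show "\<exists>N0. \<forall>N\<ge>N0. \<forall>ps.
           path_enumeration G A1 c (orig k) (dest k) N ps \<longrightarrow>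
           (\<forall>p. bilevel_feasible G A1 c (orig k) (dest k) p \<longrightarrow> p \<in> set ps)"
    using path_enumeration_outputs_feasible by blast
qed

end
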